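(* Let $(\mathscr{A},\mathscr{E})$ be an exact category. Consider a morphism of short exact sequences, i.e. short exact sequences $A'\xrightarrow{f'}B'\xrightarrow{g'}C'$ and $A\xrightarrow{f}B\xrightarrow{g}C$ in $\mathscr{E}$ and morphisms $a:A'\to A$, $b:B'\to B$, $c:C'\to C$ with $bf'=fa$ and $cg'=gb$. If $a$ and $c$ are isomorphisms, then $b$ is an isomorphism. If $a$ and $c$ are admissible monics, then $b$ is an admissible monic. If $a$ and $c$ are admissible epics, then $b$ is an admissible epic.
   Context: A kernel-cokernel pair in an additive category $\mathscr{A}$ is a pair of composable morphisms $A'\xrightarrow{i}A\xrightarrow{p}A''$ such that $i$ is a kernel of $p$ and $p$ is a cokernel of $i$. Given a class $\mathscr{E}$ of kernel-cokernel pairs, an admissible monic is a morphism $i$ for which there is $p$ with $(i,p)\in\mathscr{E}$; an admissible epic is a morphism $p$ for which there is $i$ with $(i,p)\in\mathscr{E}$. An exact structure on $\mathscr{A}$ is a class $\mathscr{E}$ of kernel-cokernel pairs closed under isomorphisms such that: all identity morphisms are admissible monics and admissible epics; admissible monics are closed under composition and admissible epics are closed under composition; the push-out of an admissible monic along an arbitrary morphism exists and yields an admissible monic; the pull-back of an admissible epic along an arbitrary morphism exists and yields an admissible epic. An exact category is a pair $(\mathscr{A},\mathscr{E})$ of an additive category and an exact structure on it; elements of $\mathscr{E}$ are called short exact sequences. *)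

theory Defs
  imports "HOL-Algebra.Group"
begin

section \<open>Categories\<close>

text \<open>
  Morphisms carry their domain and codomain. Only the values of the operations on objects and on
  composable (for addition: parallel) morphisms matter; \<open>g \<cdot>\<^bsub>C\<^esub> f\<close> is ``\<open>f\<close>, then \<open>g\<close>''.
\<close>

record ('o, 'm) cat =
  Obj :: "'o set"
  Mor :: "'m set"
  Dom :: "'m \<Rightarrow> 'o"
  Cod :: "'m \<Rightarrow> 'o"
  Ident :: "'o \<Rightarrow> 'm"
  Comp :: "'m \<Rightarrow> 'm \<Rightarrow> 'm"  (infixr "\<cdot>\<index>" 70)

definition Hom :: "('o, 'm, 'x) cat_scheme \<Rightarrow> 'o \<Rightarrow> 'o \<Rightarrow> 'm set" where
  "Hom C X Y = {f \<in> Mor C. Dom C f = X \<and> Cod C f = Y}"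

locale category =
  fixes C (structure)
  assumes Dom_Obj: "f \<in> Mor C \<Longrightarrow> Dom C f \<in> Obj C"
    and Cod_Obj: "f \<in> Mor C \<Longrightarrow> Cod C f \<in> Obj C"
    and Ident_Hom: "X \<in> Obj C \<Longrightarrow> Ident C X \<in> Hom C X X"
    and Comp_Hom: "f \<in> Hom C X Y \<Longrightarrow> g \<in> Hom C Y Z \<Longrightarrow> g \<cdot> f \<in> Hom C X Z"
    and Comp_Ident: "f \<in> Hom C X Y \<Longrightarrow> f \<cdot> Ident C X = f"
    and Ident_Comp: "f \<in> Hom C X Y \<Longrightarrow> Ident C Y \<cdot> f = f"
    and Comp_assoc: "f \<in> Hom C W X \<Longrightarrow> g \<in> Hom C X Y \<Longrightarrow> h \<in> Hom C Y Z \<Longrightarrow>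
      (h \<cdot> g) \<cdot> f = h \<cdot> (g \<cdot> f)"

definition is_isomorphism :: "('o, 'm, 'x) cat_scheme \<Rightarrow> 'm \<Rightarrow> bool" where
  "is_isomorphism C f \<longleftrightarrow> f \<in> Mor C \<and>
     (\<exists>g \<in> Hom C (Cod C f) (Dom C f).
        g \<cdot>\<^bsub>C\<^esub> f = Ident C (Dom C f) \<and> f \<cdot>\<^bsub>C\<^esub> g = Ident C (Cod C f))"

text \<open>
  \<open>is_pushout C i f f' i'\<close>: the square
  \<open>A \<midarrow>i\<rightarrow> B \<midarrow>f'\<rightarrow> P\<close>, \<open>A \<midarrow>f\<rightarrow> A' \<midarrow>i'\<rightarrow> P\<close> is a push-out,
  so \<open>i'\<close> is the push-out of \<open>i\<close> along \<open>f\<close>.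
\<close>

definition is_pushout ::
  "('o, 'm, 'x) cat_scheme \<Rightarrow> 'm \<Rightarrow> 'm \<Rightarrow> 'm \<Rightarrow> 'm \<Rightarrow> bool" where
  "is_pushout C i f f' i' \<longleftrightarrow>
     (\<exists>A B A' P. i \<in> Hom C A B \<and> f \<in> Hom C A A' \<and> f' \<in> Hom C B P \<and> i' \<in> Hom C A' P \<and>
        f' \<cdot>\<^bsub>C\<^esub> i = i' \<cdot>\<^bsub>C\<^esub> f \<and>
        (\<forall>X \<in> Obj C. \<forall>u \<in> Hom C B X. \<forall>v \<in> Hom C A' X. u \<cdot>\<^bsub>C\<^esub> i = v \<cdot>\<^bsub>C\<^esub> f \<longrightarrow>
           (\<exists>!w. w \<in> Hom C P X \<and> w \<cdot>\<^bsub>C\<^esub> f' = u \<and> w \<cdot>\<^bsub>C\<^esub> i' = v)))"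

text \<open>
  \<open>is_pullback C p f f' p'\<close>: the square
  \<open>P \<midarrow>f'\<rightarrow> B \<midarrow>p\<rightarrow> D\<close>, \<open>P \<midarrow>p'\<rightarrow> D' \<midarrow>f\<rightarrow> D\<close> is a pull-back,
  so \<open>p'\<close> is the pull-back of \<open>p\<close> along \<open>f\<close>.
\<close>

definition is_pullback ::
  "('o, 'm, 'x) cat_scheme \<Rightarrow> 'm \<Rightarrow> 'm \<Rightarrow> 'm \<Rightarrow> 'm \<Rightarrow> bool" where
  "is_pullback C p f f' p' \<longleftrightarrow>
     (\<exists>B D D' P. p \<in> Hom C B D \<and> f \<in> Hom C D' D \<and> f' \<in> Hom C P B \<and> p' \<in> Hom C P D' \<and>
        p \<cdot>\<^bsub>C\<^esub> f' = f \<cdot>\<^bsub>C\<^esub> p' \<and>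
        (\<forall>X \<in> Obj C. \<forall>u \<in> Hom C X B. \<forall>v \<in> Hom C X D'. p \<cdot>\<^bsub>C\<^esub> u = f \<cdot>\<^bsub>C\<^esub> v \<longrightarrow>
           (\<exists>!w. w \<in> Hom C X P \<and> f' \<cdot>\<^bsub>C\<^esub> w = u \<and> p' \<cdot>\<^bsub>C\<^esub> w = v)))"


section \<open>Additive categories\<close>

record ('o, 'm) add_cat = "('o, 'm) cat" +
  Add :: "'m \<Rightarrow> 'm \<Rightarrow> 'm"  (infixl "\<boxplus>\<index>" 65)
  Zero :: "'o \<Rightarrow> 'o \<Rightarrow> 'm"

definition Hom_group :: "('o, 'm, 'x) add_cat_scheme \<Rightarrow> 'o \<Rightarrow> 'o \<Rightarrow> 'm monoid" where
  "Hom_group C X Y = \<lparr>carrier = Hom C X Y, mult = Add C, one = Zero C X Y\<rparr>"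

definition is_zero_object :: "('o, 'm, 'x) cat_scheme \<Rightarrow> 'o \<Rightarrow> bool" where
  "is_zero_object C Z \<longleftrightarrow> Z \<in> Obj C \<and>
     (\<forall>X \<in> Obj C. (\<exists>!f. f \<in> Hom C X Z) \<and> (\<exists>!f. f \<in> Hom C Z X))"

definition is_biproduct ::
  "('o, 'm, 'x) add_cat_scheme \<Rightarrow> 'o \<Rightarrow> 'o \<Rightarrow> 'o \<Rightarrow> 'm \<Rightarrow> 'm \<Rightarrow> 'm \<Rightarrow> 'm \<Rightarrow> bool" where
  "is_biproduct C X Y S i\<^sub>X i\<^sub>Y p\<^sub>X p\<^sub>Y \<longleftrightarrow>
     i\<^sub>X \<in> Hom C X S \<and> i\<^sub>Y \<in> Hom C Y S \<and> p\<^sub>X \<in> Hom C S X \<and> p\<^sub>Y \<in> Hom C S Y \<and>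
     p\<^sub>X \<cdot>\<^bsub>C\<^esub> i\<^sub>X = Ident C X \<and> p\<^sub>Y \<cdot>\<^bsub>C\<^esub> i\<^sub>Y = Ident C Y \<and>
     p\<^sub>X \<cdot>\<^bsub>C\<^esub> i\<^sub>Y = Zero C Y X \<and> p\<^sub>Y \<cdot>\<^bsub>C\<^esub> i\<^sub>X = Zero C X Y \<and>
     (i\<^sub>X \<cdot>\<^bsub>C\<^esub> p\<^sub>X) \<boxplus>\<^bsub>C\<^esub> (i\<^sub>Y \<cdot>\<^bsub>C\<^esub> p\<^sub>Y) = Ident C S"

locale additive_category = category +
  assumes Hom_comm_group: "X \<in> Obj C \<Longrightarrow> Y \<in> Obj C \<Longrightarrow> comm_group (Hom_group C X Y)"
    and Comp_Add: "f \<in> Hom C X Y \<Longrightarrow> f' \<in> Hom C X Y \<Longrightarrow> g \<in> Hom C Y Z \<Longrightarrow>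
      g \<cdot> (f \<boxplus> f') = (g \<cdot> f) \<boxplus> (g \<cdot> f')"
    and Add_Comp: "f \<in> Hom C X Y \<Longrightarrow> g \<in> Hom C Y Z \<Longrightarrow> g' \<in> Hom C Y Z \<Longrightarrow>
      (g \<boxplus> g') \<cdot> f = (g \<cdot> f) \<boxplus> (g' \<cdot> f)"
    and ex_zero_object: "\<exists>Z. is_zero_object C Z"
    and ex_biproduct: "X \<in> Obj C \<Longrightarrow> Y \<in> Obj C \<Longrightarrow>
      \<exists>S i\<^sub>X i\<^sub>Y p\<^sub>X p\<^sub>Y. is_biproduct C X Y S i\<^sub>X i\<^sub>Y p\<^sub>X p\<^sub>Y"

definition is_kernel :: "('o, 'm, 'x) add_cat_scheme \<Rightarrow> 'm \<Rightarrow> 'm \<Rightarrow> bool" where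
  "is_kernel C i p \<longleftrightarrow>
     (\<exists>K A B. i \<in> Hom C K A \<and> p \<in> Hom C A B \<and> p \<cdot>\<^bsub>C\<^esub> i = Zero C K B \<and>
        (\<forall>X \<in> Obj C. \<forall>k \<in> Hom C X A. p \<cdot>\<^bsub>C\<^esub> k = Zero C X B \<longrightarrow>
           (\<exists>!u. u \<in> Hom C X K \<and> i \<cdot>\<^bsub>C\<^esub> u = k)))"

definition is_cokernel :: "('o, 'm, 'x) add_cat_scheme \<Rightarrow> 'm \<Rightarrow> 'm \<Rightarrow> bool" where
  "is_cokernel C p i \<longleftrightarrow>
     (\<exists>A B Q. i \<in> Hom C A B \<and> p \<in> Hom C B Q \<and> p \<cdot>\<^bsub>C\<^esub> i = Zero C A Q \<and>
        (\<forall>X \<in> Obj C. \<forall>k \<in> Hom C B X. k \<cdot>\<^bsub>C\<^esub> i = Zero C A X \<longrightarrow>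
           (\<exists>!u. u \<in> Hom C Q X \<and> u \<cdot>\<^bsub>C\<^esub> p = k)))"

definition kernel_cokernel_pair :: "('o, 'm, 'x) add_cat_scheme \<Rightarrow> 'm \<Rightarrow> 'm \<Rightarrow> bool" where
  "kernel_cokernel_pair C i p \<longleftrightarrow> is_kernel C i p \<and> is_cokernel C p i"


section \<open>Exact structures\<close>

definition admissible_monic :: "('m \<times> 'm) set \<Rightarrow> 'm \<Rightarrow> bool" where
  "admissible_monic E i \<longleftrightarrow> (\<exists>p. (i, p) \<in> E)"

definition admissible_epic :: "('m \<times> 'm) set \<Rightarrow> 'm \<Rightarrow> bool" where
  "admissible_epic E p \<longleftrightarrow> (\<exists>i. (i, p) \<in> E)"

text \<open>
  Push-outs and pull-backs are unique up to isomorphism and \<open>E\<close> is closed under isomorphisms, so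
  asking for one square with an admissible \<open>i'\<close> (resp. \<open>p'\<close>) amounts to asking it of all of them.
\<close>

locale exact_category = additive_category +
  fixes E :: "('m \<times> 'm) set"
  assumes E_kernel_cokernel: "(i, p) \<in> E \<Longrightarrow> kernel_cokernel_pair C i p"
    and E_iso_closed: "(i, p) \<in> E \<Longrightarrow>
      i \<in> Hom C X' X \<Longrightarrow> p \<in> Hom C X X'' \<Longrightarrow> j \<in> Hom C Y' Y \<Longrightarrow> q \<in> Hom C Y Y'' \<Longrightarrow>
      s' \<in> Hom C X' Y' \<Longrightarrow> s \<in> Hom C X Y \<Longrightarrow> s'' \<in> Hom C X'' Y'' \<Longrightarrow>
      is_isomorphism C s' \<Longrightarrow> is_isomorphism C s \<Longrightarrow> is_isomorphism C s'' \<Longrightarrow>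
      s \<cdot> i = j \<cdot> s' \<Longrightarrow> s'' \<cdot> p = q \<cdot> s \<Longrightarrow> (j, q) \<in> E"
    and Ident_monic: "X \<in> Obj C \<Longrightarrow> admissible_monic E (Ident C X)"
    and Ident_epic: "X \<in> Obj C \<Longrightarrow> admissible_epic E (Ident C X)"
    and monic_Comp: "i \<in> Hom C X Y \<Longrightarrow> j \<in> Hom C Y Z \<Longrightarrow>
      admissible_monic E i \<Longrightarrow> admissible_monic E j \<Longrightarrow> admissible_monic E (j \<cdot> i)"
    and epic_Comp: "p \<in> Hom C X Y \<Longrightarrow> q \<in> Hom C Y Z \<Longrightarrow>
      admissible_epic E p \<Longrightarrow> admissible_epic E q \<Longrightarrow> admissible_epic E (q \<cdot> p)"
    and monic_pushout: "i \<in> Hom C X Y \<Longrightarrow> admissible_monic E i \<Longrightarrow> f \<in> Hom C X X' \<Longrightarrow>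
      \<exists>f' i'. is_pushout C i f f' i' \<and> admissible_monic E i'"
    and epic_pullback: "p \<in> Hom C Y Z \<Longrightarrow> admissible_epic E p \<Longrightarrow> f \<in> Hom C Z' Z \<Longrightarrow>
      \<exists>f' p'. is_pullback C p f f' p' \<and> admissible_epic E p'"

end

theory Submission
  imports Defs
begin

text \<open>
  If \<open>a\<close> and \<open>c\<close> are isomorphisms one may assume that they are identities. Pulling \<open>g'\<close> back along
  \<open>g\<close> then produces an admissible epic \<open>q'\<close> onto \<open>B\<close> that factors as \<open>b \<cdot> w\<close>. As \<open>b\<close> is monic, \<open>w\<close>
  kills the kernel of \<open>q'\<close>, hence factors through \<open>q'\<close>, which yields the inverse of \<open>b\<close>.

  If \<open>a\<close> and \<open>c\<close> are admissible monics, pull \<open>(f, g)\<close> back along \<open>c\<close> and push \<open>(f', g')\<close> out along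
  \<open>a\<close>. By the first part the two middle objects are isomorphic, so \<open>b\<close> is the composite of the
  push-out of \<open>a\<close> (an admissible monic), an isomorphism, and the pull-back of \<open>c\<close> along \<open>g\<close>; the
  latter is a kernel of the admissible epic \<open>coker c \<cdot> g\<close>. The statement about admissible epics is
  dual.
\<close>

section \<open>Categories\<close>

context category
begin

lemma Hom_Obj: "f \<in> Hom C X Y \<Longrightarrow> X \<in> Obj C \<and> Y \<in> Obj C"
  unfolding Hom_def using Dom_Obj Cod_Obj by auto

lemma is_isomorphismI:
  assumes "f \<in> Hom C X Y" "g \<in> Hom C Y X" "g \<cdot> f = Ident C X" "f \<cdot> g = Ident C Y"
  shows "is_isomorphism C f"
  using assms unfolding is_isomorphism_def Hom_def by auto

lemma is_isomorphismE:
  assumes "is_isomorphism C f" "f \<in> Hom C X Y"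
  obtains g where "g \<in> Hom C Y X" "g \<cdot> f = Ident C X" "f \<cdot> g = Ident C Y" "is_isomorphism C g"
proof -
  obtain g where "g \<in> Hom C Y X" "g \<cdot> f = Ident C X" "f \<cdot> g = Ident C Y"
    using assms unfolding is_isomorphism_def Hom_def by auto
  then show thesis
    using that is_isomorphismI assms(2) by blast
qed

lemma is_isomorphism_Ident: "X \<in> Obj C \<Longrightarrow> is_isomorphism C (Ident C X)"
  using is_isomorphismI Ident_Hom Comp_Ident by metis

text \<open>Inverting the two parallel sides \<open>u\<close> and \<open>s\<close> of a commutative
  square gives the square with sides \<open>v\<close> and \<open>t\<close>. It serves to turn
  isomorphisms of sequences around when passing to the opposite category.\<close>

lemma inverse_square:
  assumes "p \<in> Hom C A B" "q \<in> Hom C A' B'" "u \<in> Hom C A' A" "s \<in> Hom C B' B"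
    "v \<in> Hom C A A'" "t \<in> Hom C B B'" "u \<cdot> v = Ident C A" "t \<cdot> s = Ident C B'" "p \<cdot> u = s \<cdot> q"
  shows "t \<cdot> p = q \<cdot> v"
proof -
  have "p = s \<cdot> (q \<cdot> v)"
    using Comp_assoc[OF assms(5,3,1)] Comp_assoc[OF assms(5,2,4)] assms Comp_Ident by metis
  then have "t \<cdot> p = (t \<cdot> s) \<cdot> (q \<cdot> v)"
    using Comp_assoc[OF Comp_Hom[OF assms(5,2)] assms(4,6)] by simp
  then show ?thesis
    using Ident_Comp[OF Comp_Hom[OF assms(5,2)]] assms(8) by simp
qed

section \<open>Pull-back squares with named corners\<close>

lemma is_pullback_Hom:
  assumes "is_pullback C p f f' p'" "p \<in> Hom C B D" "f \<in> Hom C D' D"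
  shows "\<exists>P. f' \<in> Hom C P B \<and> p' \<in> Hom C P D'"
proof -
  obtain B\<^sub>0 D\<^sub>0 D\<^sub>0' P where "p \<in> Hom C B\<^sub>0 D\<^sub>0" "f \<in> Hom C D\<^sub>0' D\<^sub>0" "f' \<in> Hom C P B\<^sub>0" "p' \<in> Hom C P D\<^sub>0'"
    using assms(1) unfolding is_pullback_def by blast
  then show ?thesis
    using assms(2,3) by (auto simp: Hom_def)
qed

text \<open>The definition hides the corners behind existential quantifiers; here they are fixed by
  the caller, and the universal property is split into existence and joint cancellation.\<close>

lemma is_pullback_universal:
  assumes "is_pullback C p f f' p'" "p \<in> Hom C B D" "f \<in> Hom C D' D"
    and "f' \<in> Hom C P B" "p' \<in> Hom C P D'"
  shows "p \<cdot> f' = f \<cdot> p'"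
    and "u \<in> Hom C X B \<Longrightarrow> v \<in> Hom C X D' \<Longrightarrow> p \<cdot> u = f \<cdot> v \<Longrightarrow>
       \<exists>w \<in> Hom C X P. f' \<cdot> w = u \<and> p' \<cdot> w = v"
    and "w \<in> Hom C X P \<Longrightarrow> w' \<in> Hom C X P \<Longrightarrow> f' \<cdot> w = f' \<cdot> w' \<Longrightarrow> p' \<cdot> w = p' \<cdot> w' \<Longrightarrow>
       w = w'"
proof -
  obtain B\<^sub>0 D\<^sub>0 D\<^sub>0' P\<^sub>0
    where H: "p \<in> Hom C B\<^sub>0 D\<^sub>0" "f \<in> Hom C D\<^sub>0' D\<^sub>0" "f' \<in> Hom C P\<^sub>0 B\<^sub>0" "p' \<in> Hom C P\<^sub>0 D\<^sub>0'"
      and square: "p \<cdot> f' = f \<cdot> p'"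
      and univ\<^sub>0: "\<forall>X \<in> Obj C. \<forall>u \<in> Hom C X B\<^sub>0. \<forall>v \<in> Hom C X D\<^sub>0'. p \<cdot> u = f \<cdot> v \<longrightarrow>
        (\<exists>!w. w \<in> Hom C X P\<^sub>0 \<and> f' \<cdot> w = u \<and> p' \<cdot> w = v)"
    using assms(1) unfolding is_pullback_def by (elim exE conjE)
  have "B\<^sub>0 = B" "D\<^sub>0' = D'" "P\<^sub>0 = P"
    using H assms(2-5) by (auto simp: Hom_def)
  with univ\<^sub>0 have univ: "\<exists>!w. w \<in> Hom C X P \<and> f' \<cdot> w = u \<and> p' \<cdot> w = v"
    if "X \<in> Obj C" "u \<in> Hom C X B" "v \<in> Hom C X D'" "p \<cdot> u = f \<cdot> v" for X u v
    using that by simp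
  show "p \<cdot> f' = f \<cdot> p'"
    by (rule square)
  show "\<exists>w \<in> Hom C X P. f' \<cdot> w = u \<and> p' \<cdot> w = v"
    if "u \<in> Hom C X B" "v \<in> Hom C X D'" "p \<cdot> u = f \<cdot> v"
    using univ that Hom_Obj by blast
  show "w = w'"
    if w: "w \<in> Hom C X P" "w' \<in> Hom C X P" "f' \<cdot> w = f' \<cdot> w'" "p' \<cdot> w = p' \<cdot> w'"
  proof -
    \<comment> \<open>The components of \<open>w\<close> form a commuting cone, so \<open>w\<close>
      and \<open>w'\<close> are both its unique mediating morphism.\<close>
    have "p \<cdot> (f' \<cdot> w) = f \<cdot> (p' \<cdot> w)"
      using Comp_assoc[OF w(1) assms(4,2)] Comp_assoc[OF w(1) assms(5,3)] square by simp
    then show ?thesis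
      using univ[of X "f' \<cdot> w" "p' \<cdot> w"] w Comp_Hom[OF w(1)] assms(4,5) Hom_Obj by metis
  qed
qed

end


section \<open>Duality\<close>

text \<open>\<open>Zero\<close> is indexed by source and target, so its arguments are exchanged
  along with \<open>Dom\<close> and \<open>Cod\<close>. Updating the record of \<open>C\<close>
  keeps its type, so all definitions apply to the opposite category directly.\<close>

definition op_cat :: "('o, 'm, 'x) add_cat_scheme \<Rightarrow> ('o, 'm, 'x) add_cat_scheme" where
  "op_cat C = C\<lparr>Dom := Cod C, Cod := Dom C, Comp := \<lambda>g f. f \<cdot>\<^bsub>C\<^esub> g, Zero := \<lambda>X Y. Zero C Y X\<rparr>"

lemma op_cat_simps [simp]:
  "Obj (op_cat C) = Obj C" "Ident (op_cat C) = Ident C" "Add (op_cat C) = Add C"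
  "Zero (op_cat C) X Y = Zero C Y X" "g \<cdot>\<^bsub>op_cat C\<^esub> f = f \<cdot>\<^bsub>C\<^esub> g"
  "Mor (op_cat C) = Mor C" "Dom (op_cat C) = Cod C" "Cod (op_cat C) = Dom C"
  by (simp_all add: op_cat_def)

lemma Hom_op_cat [simp]: "Hom (op_cat C) X Y = Hom C Y X"
  by (auto simp: Hom_def)

lemma Hom_group_op_cat: "Hom_group (op_cat C) X Y = Hom_group C Y X"
  by (simp add: Hom_group_def)

lemma is_isomorphism_op_cat [simp]: "is_isomorphism (op_cat C) f = is_isomorphism C f"
  by (auto simp: is_isomorphism_def)

lemma is_kernel_op_cat [simp]: "is_kernel (op_cat C) p i = is_cokernel C p i"
  unfolding is_kernel_def is_cokernel_def by (simp, blast)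

lemma is_cokernel_op_cat [simp]: "is_cokernel (op_cat C) i p = is_kernel C i p"
  unfolding is_kernel_def is_cokernel_def by (simp, blast)

lemma is_pullback_op_cat [simp]: "is_pullback (op_cat C) p f f' p' = is_pushout C p f f' p'"
  unfolding is_pullback_def is_pushout_def by (simp, blast)

lemma is_pushout_op_cat [simp]: "is_pushout (op_cat C) p f f' p' = is_pullback C p f f' p'"
  unfolding is_pullback_def is_pushout_def by (simp, blast)

text \<open>A short exact sequence \<open>(i, p)\<close> reads \<open>(p, i)\<close> in the opposite
  category, so the opposite exact structure is the converse relation.\<close>

lemma admissible_converse [simp]:
  "admissible_monic (E\<inverse>) = admissible_epic E" "admissible_epic (E\<inverse>) = admissible_monic E"
  by (auto simp: admissible_monic_def admissible_epic_def)

lemma (in additive_category) additive_category_op_cat: "additive_category (op_cat C)"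
proof (intro additive_category.intro category.intro additive_category_axioms.intro)
  fix X Y assume "X \<in> Obj (op_cat C)" "Y \<in> Obj (op_cat C)"
  then show "comm_group (Hom_group (op_cat C) X Y)"
    by (simp add: Hom_group_op_cat Hom_comm_group)
next
  show "\<exists>Z. is_zero_object (op_cat C) Z"
    using ex_zero_object unfolding is_zero_object_def by (simp, metis)
next
  fix X Y assume "X \<in> Obj (op_cat C)" "Y \<in> Obj (op_cat C)"
  then obtain S i j p q where "is_biproduct C X Y S i j p q"
    using ex_biproduct[of X Y] unfolding op_cat_simps by blast
  \<comment> \<open>Duality exchanges the injections and the projections of a biproduct.\<close>
  then have "is_biproduct (op_cat C) X Y S p q i j"
    by (simp add: is_biproduct_def)
  then show "\<exists>S i j p q. is_biproduct (op_cat C) X Y S i j p q"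
    by blast
qed (auto simp: Dom_Obj Cod_Obj Ident_Hom Comp_Hom Comp_Ident Ident_Comp Comp_assoc Comp_Add Add_Comp)

text \<open>The axioms are self-dual or come in dual pairs. Only closure under isomorphisms needs
  work: \<open>s'\<close>, \<open>s\<close>, \<open>s''\<close> now point the wrong way and are
  replaced by their inverses \<open>t'\<close>, \<open>t\<close>, \<open>t''\<close>.\<close>

lemma (in exact_category) exact_category_op_cat: "exact_category (op_cat C) (E\<inverse>)"
proof (intro exact_category.intro[OF additive_category_op_cat] exact_category_axioms.intro, goal_cases)
  case (1 i p)
  then show ?case
    using E_kernel_cokernel by (auto simp: kernel_cokernel_pair_def)
next
  case (2 i p X' X X'' j Y' Y q Y'' s' s s'')
  then have H: "p \<in> Hom C X'' X" "i \<in> Hom C X X'" "q \<in> Hom C Y'' Y" "j \<in> Hom C Y Y'"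
    and s: "s' \<in> Hom C Y' X'" "s \<in> Hom C Y X" "s'' \<in> Hom C Y'' X''"
    and eq: "i \<cdot> s = s' \<cdot> j" "p \<cdot> s'' = s \<cdot> q" and E: "(p, i) \<in> E"
    and iso: "is_isomorphism C s'" "is_isomorphism C s" "is_isomorphism C s''"
    by simp_all
  obtain t' where t': "t' \<in> Hom C X' Y'" "t' \<cdot> s' = Ident C Y'" "is_isomorphism C t'"
    by (rule is_isomorphismE[OF iso(1) s(1)])
  obtain t where t: "t \<in> Hom C X Y" "t \<cdot> s = Ident C Y" "s \<cdot> t = Ident C X" "is_isomorphism C t"
    by (rule is_isomorphismE[OF iso(2) s(2)])
  obtain t'' where t'': "t'' \<in> Hom C X'' Y''" "s'' \<cdot> t'' = Ident C X''" "is_isomorphism C t''"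
    by (rule is_isomorphismE[OF iso(3) s(3)])
  have "t \<cdot> p = q \<cdot> t''"
    using inverse_square[OF H(1) H(3) s(3) s(2) t''(1) t(1) t''(2) t(2) eq(2)] .
  moreover have "t' \<cdot> i = j \<cdot> t"
    using inverse_square[OF H(2) H(4) s(2) s(1) t(1) t'(1) t(3) t'(2) eq(1)] .
  ultimately have "(q, j) \<in> E"
    using E_iso_closed[OF E H t''(1) t(1) t'(1) t''(3) t(4) t'(3)] by simp
  then show ?case
    by simp
qed (auto simp: Ident_monic Ident_epic monic_Comp epic_Comp monic_pushout epic_pullback)


section \<open>Additive structure\<close>

context additive_category
begin

lemma Zero_Hom: "X \<in> Obj C \<Longrightarrow> Y \<in> Obj C \<Longrightarrow> Zero C X Y \<in> Hom C X Y"
  using comm_group.axioms(2)[OF Hom_comm_group] group.is_monoid monoid.one_closed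
  by (fastforce simp: Hom_group_def)

lemma Add_Hom:
  assumes "f \<in> Hom C X Y" "g \<in> Hom C X Y"
  shows "f \<boxplus> g \<in> Hom C X Y"
proof -
  interpret comm_group "Hom_group C X Y"
    using Hom_comm_group Hom_Obj[OF assms(1)] by blast
  show ?thesis
    using m_closed assms by (simp add: Hom_group_def)
qed

lemma Add_Zero:
  assumes "f \<in> Hom C X Y"
  shows "f \<boxplus> Zero C X Y = f"
proof -
  interpret comm_group "Hom_group C X Y"
    using Hom_comm_group Hom_Obj[OF assms(1)] by blast
  show ?thesis
    using r_one assms by (simp add: Hom_group_def)
qed

lemma Add_cancel_left:
  assumes "f \<in> Hom C X Y" "g \<in> Hom C X Y" "h \<in> Hom C X Y" "f \<boxplus> g = f \<boxplus> h"
  shows "g = h"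
proof -
  interpret comm_group "Hom_group C X Y"
    using Hom_comm_group Hom_Obj[OF assms(1)] by blast
  show ?thesis
    using Units_l_cancel[of f g h] assms Units_eq by (simp add: Hom_group_def)
qed

text \<open>This is the difference \<open>g - f\<close>, stated through \<open>Add\<close> because
  the record carries no subtraction.\<close>

lemma ex_complement:
  assumes "f \<in> Hom C X Y" "g \<in> Hom C X Y"
  shows "\<exists>h \<in> Hom C X Y. f \<boxplus> h = g"
proof -
  interpret comm_group "Hom_group C X Y"
    using Hom_comm_group Hom_Obj[OF assms(1)] by blast
  let ?h = "inv\<^bsub>Hom_group C X Y\<^esub> f \<otimes>\<^bsub>Hom_group C X Y\<^esub> g"
  have c: "f \<in> carrier (Hom_group C X Y)" "g \<in> carrier (Hom_group C X Y)"
    using assms by (simp_all add: Hom_group_def)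
  then have "?h \<in> carrier (Hom_group C X Y)" "f \<otimes>\<^bsub>Hom_group C X Y\<^esub> ?h = g"
    by (simp_all add: m_assoc[symmetric])
  then show ?thesis
    by (auto simp: Hom_group_def)
qed

lemma Comp_Zero:
  assumes "g \<in> Hom C Y Z" "X \<in> Obj C"
  shows "g \<cdot> Zero C X Y = Zero C X Z"
proof -
  have z: "Zero C X Y \<in> Hom C X Y" "Zero C X Z \<in> Hom C X Z"
    using Zero_Hom Hom_Obj assms by blast+
  have gz: "g \<cdot> Zero C X Y \<in> Hom C X Z"
    using Comp_Hom[OF z(1) assms(1)] .
  show ?thesis
    \<comment> \<open>With \<open>0\<close> the zero morphism,
      \<open>g0 + g0 = g(0 + 0) = g0 = g0 + 0\<close>; cancel \<open>g0\<close>.\<close>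
    using Add_cancel_left[OF gz gz z(2)] Comp_Add[OF z(1) z(1) assms(1)]
      Add_Zero[OF z(1)] Add_Zero[OF gz] by simp
qed

lemma Zero_Comp:
  assumes "f \<in> Hom C X Y" "Z \<in> Obj C"
  shows "Zero C Y Z \<cdot> f = Zero C X Z"
  using additive_category.Comp_Zero[OF additive_category_op_cat, of f Y X Z] assms by simp

end


section \<open>Exact categories\<close>

context exact_category
begin

section \<open>Short exact sequences as kernels and cokernels\<close>

lemma kernelI:
  assumes "i \<in> Hom C A B" "p \<in> Hom C B D" "p \<cdot> i = Zero C A D"
    and "\<And>X k. k \<in> Hom C X B \<Longrightarrow> p \<cdot> k = Zero C X D \<Longrightarrow> \<exists>u \<in> Hom C X A. i \<cdot> u = k"
    and "\<And>X u v. u \<in> Hom C X A \<Longrightarrow> v \<in> Hom C X A \<Longrightarrow> i \<cdot> u = i \<cdot> v \<Longrightarrow> u = v"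
  shows "is_kernel C i p"
proof -
  have "\<exists>!u. u \<in> Hom C X A \<and> i \<cdot> u = k" if k: "k \<in> Hom C X B" "p \<cdot> k = Zero C X D" for X k
  proof -
    obtain u where "u \<in> Hom C X A" "i \<cdot> u = k"
      using assms(4)[OF k] by blast
    then show ?thesis
      using assms(5)[of _ X] by (intro ex1I[of _ u]) simp_all
  qed
  then show ?thesis
    unfolding is_kernel_def by (intro exI[of _ A] exI[of _ B] exI[of _ D]) (simp add: assms(1-3))
qed

lemma short_exact_Hom:
  assumes "(i, p) \<in> E"
  shows "p \<in> Hom C B D \<Longrightarrow> \<exists>A. i \<in> Hom C A B" "i \<in> Hom C A B \<Longrightarrow> \<exists>D. p \<in> Hom C B D"
proof -
  obtain A\<^sub>0 B\<^sub>0 D\<^sub>0 where "i \<in> Hom C A\<^sub>0 B\<^sub>0" "p \<in> Hom C B\<^sub>0 D\<^sub>0"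
    using E_kernel_cokernel[OF assms] unfolding kernel_cokernel_pair_def is_kernel_def
    by (elim exE conjE)
  then show "p \<in> Hom C B D \<Longrightarrow> \<exists>A. i \<in> Hom C A B" "i \<in> Hom C A B \<Longrightarrow> \<exists>D. p \<in> Hom C B D"
    by (auto simp: Hom_def)
qed

lemma short_exact_kernel:
  assumes "(i, p) \<in> E" "i \<in> Hom C A B" "p \<in> Hom C B D"
  shows "p \<cdot> i = Zero C A D"
    and "k \<in> Hom C X B \<Longrightarrow> p \<cdot> k = Zero C X D \<Longrightarrow> \<exists>u \<in> Hom C X A. i \<cdot> u = k"
    and "u \<in> Hom C X A \<Longrightarrow> v \<in> Hom C X A \<Longrightarrow> i \<cdot> u = i \<cdot> v \<Longrightarrow> u = v"
proof -
  obtain A\<^sub>0 B\<^sub>0 D\<^sub>0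
    where H: "i \<in> Hom C A\<^sub>0 B\<^sub>0" "p \<in> Hom C B\<^sub>0 D\<^sub>0"
      and pi\<^sub>0: "p \<cdot> i = Zero C A\<^sub>0 D\<^sub>0"
      and ker\<^sub>0: "\<forall>X \<in> Obj C. \<forall>k \<in> Hom C X B\<^sub>0. p \<cdot> k = Zero C X D\<^sub>0 \<longrightarrow>
        (\<exists>!u. u \<in> Hom C X A\<^sub>0 \<and> i \<cdot> u = k)"
    using E_kernel_cokernel[OF assms(1)] unfolding kernel_cokernel_pair_def is_kernel_def
    by (elim exE conjE)
  have eqs: "A\<^sub>0 = A" "B\<^sub>0 = B" "D\<^sub>0 = D"
    using H assms(2,3) by (auto simp: Hom_def)
  have pi: "p \<cdot> i = Zero C A D"
    using pi\<^sub>0 eqs by simp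
  have ker: "\<exists>!u. u \<in> Hom C X A \<and> i \<cdot> u = k"
    if "X \<in> Obj C" "k \<in> Hom C X B" "p \<cdot> k = Zero C X D" for X k
    using ker\<^sub>0 eqs that by simp
  show "p \<cdot> i = Zero C A D"
    by (rule pi)
  show "\<exists>u \<in> Hom C X A. i \<cdot> u = k" if "k \<in> Hom C X B" "p \<cdot> k = Zero C X D"
    using ker that Hom_Obj by blast
  show "u = v" if uv: "u \<in> Hom C X A" "v \<in> Hom C X A" "i \<cdot> u = i \<cdot> v"
  proof -
    have "p \<cdot> (i \<cdot> u) = Zero C X D"
      using Comp_assoc[OF uv(1) assms(2,3)] pi Zero_Comp[OF uv(1)] Hom_Obj[OF assms(3)] by simp
    then show ?thesis
      using ker[of X "i \<cdot> u"] uv Comp_Hom[OF uv(1) assms(2)] Hom_Obj by metis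
  qed
qed

text \<open>In the opposite category \<open>p\<close> is a kernel of \<open>i\<close>, so this is
  the kernel property read there.\<close>

lemma short_exact_cokernel:
  assumes "(i, p) \<in> E" "i \<in> Hom C A B" "p \<in> Hom C B D"
  shows "k \<in> Hom C B X \<Longrightarrow> k \<cdot> i = Zero C A X \<Longrightarrow> \<exists>u \<in> Hom C D X. u \<cdot> p = k"
    and "u \<in> Hom C D X \<Longrightarrow> v \<in> Hom C D X \<Longrightarrow> u \<cdot> p = v \<cdot> p \<Longrightarrow> u = v"
proof -
  have "(p, i) \<in> E\<inverse>" "p \<in> Hom (op_cat C) D B" "i \<in> Hom (op_cat C) B A"
    using assms by simp_all
  note op = exact_category.short_exact_kernel(2,3)[OF exact_category_op_cat this]
  show "k \<in> Hom C B X \<Longrightarrow> k \<cdot> i = Zero C A X \<Longrightarrow> \<exists>u \<in> Hom C D X. u \<cdot> p = k"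
    using op(1)[of k X] by simp
  show "u \<in> Hom C D X \<Longrightarrow> v \<in> Hom C D X \<Longrightarrow> u \<cdot> p = v \<cdot> p \<Longrightarrow> u = v"
    using op(2)[of u X v] by simp
qed

text \<open>An identity starts some short exact sequence; transporting it along \<open>s\<close> in
  the middle, with identities at the ends, gives one that starts with \<open>s\<close>.\<close>

lemma iso_admissible_monic:
  assumes "is_isomorphism C s"
  shows "admissible_monic E s"
proof -
  obtain X Y where s: "s \<in> Hom C X Y"
    using assms unfolding is_isomorphism_def Hom_def by blast
  obtain p where p: "(Ident C X, p) \<in> E"
    using Ident_monic Hom_Obj[OF s] unfolding admissible_monic_def by blast
  obtain Z where pH: "p \<in> Hom C X Z"
    using short_exact_Hom(2)[OF p] Ident_Hom Hom_Obj[OF s] by blast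
  obtain t where t: "t \<in> Hom C Y X" "t \<cdot> s = Ident C X"
    by (rule is_isomorphismE[OF assms s])
  have id: "Ident C X \<in> Hom C X X" "Ident C Z \<in> Hom C Z Z"
    "is_isomorphism C (Ident C X)" "is_isomorphism C (Ident C Z)"
    using Ident_Hom is_isomorphism_Ident Hom_Obj[OF pH] by auto
  have "Ident C Z \<cdot> p = (p \<cdot> t) \<cdot> s"
    using Comp_assoc[OF s t(1) pH] t(2) Comp_Ident[OF pH] Ident_Comp[OF pH] by simp
  then have "(s, p \<cdot> t) \<in> E"
    using E_iso_closed[OF p id(1) pH s Comp_Hom[OF t(1) pH] id(1) s id(2) id(3) assms id(4)]
    by simp
  then show ?thesis
    unfolding admissible_monic_def by blast
qed

text \<open>Two kernels of \<open>p\<close> differ by an isomorphism, and \<open>E\<close> is closed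
  under isomorphisms. This is the way admissible monics are recognised below.\<close>

lemma kernel_of_admissible_epic:
  assumes "admissible_epic E p" "is_kernel C j p"
  shows "(j, p) \<in> E"
proof -
  obtain i where i: "(i, p) \<in> E"
    using assms(1) unfolding admissible_epic_def by blast
  obtain K B D where j: "j \<in> Hom C K B" "p \<in> Hom C B D" "p \<cdot> j = Zero C K D"
    and ker: "\<And>X k. X \<in> Obj C \<Longrightarrow> k \<in> Hom C X B \<Longrightarrow> p \<cdot> k = Zero C X D \<Longrightarrow>
      \<exists>!u. u \<in> Hom C X K \<and> j \<cdot> u = k"
    using assms(2) unfolding is_kernel_def by blast
  obtain A where A: "i \<in> Hom C A B"
    using short_exact_Hom(1)[OF i j(2)] by blast
  note iker = short_exact_kernel[OF i A j(2)]
  obtain s where s: "s \<in> Hom C A K" "j \<cdot> s = i"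
    using ker A iker(1) Hom_Obj by blast
  obtain t where t: "t \<in> Hom C K A" "i \<cdot> t = j"
    using iker(2) j by blast
  have ts: "t \<cdot> s \<in> Hom C A A" "s \<cdot> t \<in> Hom C K K"
    using Comp_Hom s t by blast+
  have id: "Ident C A \<in> Hom C A A" "Ident C K \<in> Hom C K K"
    using Ident_Hom Hom_Obj s(1) by blast+
  have "i \<cdot> (t \<cdot> s) = i \<cdot> Ident C A"
    using Comp_assoc[OF s(1) t(1) A] s t Comp_Ident[OF A] by simp
  then have "t \<cdot> s = Ident C A"
    using iker(3) ts(1) id(1) by blast
  moreover have "j \<cdot> (s \<cdot> t) = j \<cdot> Ident C K"
    using Comp_assoc[OF t(1) s(1) j(1)] s t Comp_Ident[OF j(1)] by simp
  then have "s \<cdot> t = Ident C K"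
    using ker[OF _ j(1,3)] ts(2) id(2) Comp_Ident[OF j(1)] Hom_Obj[OF j(1)] by metis
  ultimately have iso: "is_isomorphism C s"
    using is_isomorphismI[OF s(1) t(1)] by blast
  have B: "Ident C B \<in> Hom C B B" "is_isomorphism C (Ident C B)"
    "Ident C D \<in> Hom C D D" "is_isomorphism C (Ident C D)"
    using Ident_Hom is_isomorphism_Ident Hom_Obj[OF j(2)] by auto
  show ?thesis
    using E_iso_closed[OF i A j(2) j(1) j(2) s(1) B(1) B(3) iso B(2) B(4)]
      s(2) Ident_Comp[OF A] Ident_Comp[OF j(2)] Comp_Ident[OF j(2)] by simp
qed

section \<open>Pull-backs and push-outs of short exact sequences\<close>

lemma pullback_short_exact:
  assumes "is_pullback C p f f' p'" "(i, p) \<in> E" "p \<in> Hom C B D" "f \<in> Hom C D' D"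
    and "i \<in> Hom C A B" "admissible_epic E p'"
  shows "\<exists>n. (n, p') \<in> E \<and> f' \<cdot> n = i"
proof -
  obtain P where PH: "f' \<in> Hom C P B" "p' \<in> Hom C P D'"
    using is_pullback_Hom[OF assms(1,3,4)] by blast
  note pullback = is_pullback_universal[OF assms(1,3,4) PH]
  note P = PH pullback(1) and lift = pullback(2) and unique = pullback(3)
  note iker = short_exact_kernel[OF assms(2,5,3)]
  have obj: "A \<in> Obj C" "D' \<in> Obj C"
    using Hom_Obj assms(4,5) by blast+
  \<comment> \<open>Both sides vanish, so \<open>i\<close> and the zero morphism are the components
    of a morphism \<open>n\<close> into the pull-back; it will be the kernel of
    \<open>p'\<close>.\<close>
  have "p \<cdot> i = f \<cdot> Zero C A D'"
    using iker(1) Comp_Zero[OF assms(4) obj(1)] by simp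
  then obtain n where n: "n \<in> Hom C A P" "f' \<cdot> n = i" "p' \<cdot> n = Zero C A D'"
    using lift assms(5) Zero_Hom obj by blast
  have "is_kernel C n p'"
  proof (rule kernelI[OF n(1) P(2) n(3)])
    fix X k assume k: "k \<in> Hom C X P" "p' \<cdot> k = Zero C X D'"
    have fk: "f' \<cdot> k \<in> Hom C X B"
      using Comp_Hom[OF k(1) P(1)] .
    have "p \<cdot> (f' \<cdot> k) = Zero C X D"
      using Comp_assoc[OF k(1) P(1) assms(3)] Comp_assoc[OF k(1) P(2) assms(4)] P(3) k(2)
        Comp_Zero[OF assms(4)] Hom_Obj[OF k(1)] by simp
    then obtain u where u: "u \<in> Hom C X A" "i \<cdot> u = f' \<cdot> k"
      using iker(2) fk by auto
    have "f' \<cdot> (n \<cdot> u) = f' \<cdot> k"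
      using Comp_assoc[OF u(1) n(1) P(1)] n(2) u(2) by simp
    moreover have "p' \<cdot> (n \<cdot> u) = p' \<cdot> k"
      using Comp_assoc[OF u(1) n(1) P(2)] n(3) k(2) Zero_Comp[OF u(1) obj(2)] by simp
    ultimately have "n \<cdot> u = k"
      using unique Comp_Hom[OF u(1) n(1)] k(1) by blast
    then show "\<exists>u \<in> Hom C X A. n \<cdot> u = k"
      using u(1) by blast
  next
    fix X u v assume uv: "u \<in> Hom C X A" "v \<in> Hom C X A" "n \<cdot> u = n \<cdot> v"
    have "i \<cdot> u = i \<cdot> v"
      using Comp_assoc[OF uv(1) n(1) P(1)] Comp_assoc[OF uv(2) n(1) P(1)] n(2) uv(3) by simp
    then show "u = v"
      using iker(3) uv by simp
  qed
  then show ?thesis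
    using kernel_of_admissible_epic assms(6) n(2) by blast
qed

lemma iso_admissible_epic: "is_isomorphism C s \<Longrightarrow> admissible_epic E s"
  using exact_category.iso_admissible_monic[OF exact_category_op_cat, of s] by simp

text \<open>The axiom supplies one square, with \<open>q\<close> admissible. The given square is
  isomorphic to it through \<open>s\<close>, so \<open>p' = q \<cdot> s\<close> is a composite of
  admissible epics.\<close>

lemma admissible_epic_pullback:
  assumes "is_pullback C p f f' p'" "admissible_epic E p" "p \<in> Hom C B D" "f \<in> Hom C D' D"
  shows "admissible_epic E p'"
proof -
  obtain g q where gq: "is_pullback C p f g q" "admissible_epic E q"
    using epic_pullback[OF assms(3,2,4)] by blast
  obtain P where PH: "f' \<in> Hom C P B" "p' \<in> Hom C P D'"
    using is_pullback_Hom[OF assms(1,3,4)] by blast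
  note pullback = is_pullback_universal[OF assms(1,3,4) PH]
  note P = PH pullback(1) and lift = pullback(2) and unique = pullback(3)
  obtain Q where QH: "g \<in> Hom C Q B" "q \<in> Hom C Q D'"
    using is_pullback_Hom[OF gq(1) assms(3,4)] by blast
  note pullback' = is_pullback_universal[OF gq(1) assms(3,4) QH]
  note Q = QH pullback'(1) and lift' = pullback'(2) and unique' = pullback'(3)
  obtain s where s: "s \<in> Hom C P Q" "g \<cdot> s = f'" "q \<cdot> s = p'"
    using lift'[OF P] by blast
  obtain t where t: "t \<in> Hom C Q P" "f' \<cdot> t = g" "p' \<cdot> t = q"
    using lift[OF Q] by blast
  have id: "Ident C P \<in> Hom C P P" "Ident C Q \<in> Hom C Q Q"
    using Ident_Hom Hom_Obj s(1) by blast+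
  have "t \<cdot> s = Ident C P"
    using unique[OF Comp_Hom[OF s(1) t(1)] id(1)] Comp_assoc[OF s(1) t(1) P(1)]
      Comp_assoc[OF s(1) t(1) P(2)] s t Comp_Ident[OF P(1)] Comp_Ident[OF P(2)] by simp
  moreover have "s \<cdot> t = Ident C Q"
    using unique'[OF Comp_Hom[OF t(1) s(1)] id(2)] Comp_assoc[OF t(1) s(1) Q(1)]
      Comp_assoc[OF t(1) s(1) Q(2)] s t Comp_Ident[OF Q(1)] Comp_Ident[OF Q(2)] by simp
  ultimately have "admissible_epic E s"
    using iso_admissible_epic is_isomorphismI[OF s(1) t(1)] by blast
  then show ?thesis
    using epic_Comp[OF s(1) Q(2)] gq(2) s(3) by simp
qed

text \<open>Dual to \<open>pullback_short_exact\<close>. Admissibility of \<open>i'\<close> comes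
  first, by dualising \<open>admissible_epic_pullback\<close>, since the square is an arbitrary
  push-out.\<close>

lemma pushout_short_exact:
  assumes "is_pushout C i f f' i'" "(i, p) \<in> E" "i \<in> Hom C A B" "f \<in> Hom C A A'"
    and "p \<in> Hom C B D"
  shows "\<exists>r. (i', r) \<in> E \<and> r \<cdot> f' = p"
proof -
  interpret op: exact_category "op_cat C" "E\<inverse>"
    by (rule exact_category_op_cat)
  have "admissible_epic (E\<inverse>) i'"
    by (rule op.admissible_epic_pullback[of i f f' i' B A A'])
      (use assms in \<open>auto simp: admissible_monic_def\<close>)
  then show ?thesis
    using op.pullback_short_exact[of i f f' i' p B A A' D] assms by simp
qed

lemma admissible_monic_pullback:
  assumes "is_pullback C g c d p" "admissible_monic E c" "admissible_epic E g"
    and "g \<in> Hom C B D" "c \<in> Hom C D' D"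
  shows "admissible_monic E d"
proof -
  obtain q where q: "(c, q) \<in> E"
    using assms(2) unfolding admissible_monic_def by blast
  then obtain Q where Q: "q \<in> Hom C D Q"
    using short_exact_Hom(2) assms(5) by blast
  note cker = short_exact_kernel[OF q assms(5) Q]
  obtain P where PH: "d \<in> Hom C P B" "p \<in> Hom C P D'"
    using is_pullback_Hom[OF assms(1,4,5)] by blast
  note pullback = is_pullback_universal[OF assms(1,4,5) PH]
  note P = PH pullback(1) and lift = pullback(2) and unique = pullback(3)
  have qg: "q \<cdot> g \<in> Hom C B Q"
    using Comp_Hom[OF assms(4) Q] .
  \<comment> \<open>If \<open>q \<cdot> g\<close> kills \<open>k\<close>, then
    \<open>g \<cdot> k\<close> factors through \<open>c\<close>, the kernel of \<open>q\<close>;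
    this factor and \<open>k\<close> together define a morphism into the pull-back.\<close>
  have "is_kernel C d (q \<cdot> g)"
  proof (rule kernelI[OF P(1) qg])
    show "(q \<cdot> g) \<cdot> d = Zero C P Q"
      using Comp_assoc[OF P(1) assms(4) Q] Comp_assoc[OF P(2) assms(5) Q] P(3) cker(1)
        Zero_Comp[OF P(2)] Hom_Obj[OF Q] by simp
  next
    fix X k assume k: "k \<in> Hom C X B" "(q \<cdot> g) \<cdot> k = Zero C X Q"
    have "q \<cdot> (g \<cdot> k) = Zero C X Q"
      using Comp_assoc[OF k(1) assms(4) Q] k(2) by simp
    then obtain v where "v \<in> Hom C X D'" "c \<cdot> v = g \<cdot> k"
      using cker(2)[OF Comp_Hom[OF k(1) assms(4)]] by blast
    then show "\<exists>u \<in> Hom C X P. d \<cdot> u = k"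
      using lift[OF k(1)] by metis
  next
    fix X u v assume uv: "u \<in> Hom C X P" "v \<in> Hom C X P" "d \<cdot> u = d \<cdot> v"
    have "c \<cdot> (p \<cdot> u) = c \<cdot> (p \<cdot> v)"
      using Comp_assoc[OF uv(1) P(1) assms(4)] Comp_assoc[OF uv(2) P(1) assms(4)]
        Comp_assoc[OF uv(1) P(2) assms(5)] Comp_assoc[OF uv(2) P(2) assms(5)] P(3) uv(3) by simp
    then show "u = v"
      using unique uv cker(3) Comp_Hom[OF uv(1) P(2)] Comp_Hom[OF uv(2) P(2)] by blast
  qed
  moreover have "admissible_epic E (q \<cdot> g)"
    using epic_Comp[OF assms(4) Q assms(3)] q unfolding admissible_epic_def by blast
  ultimately show ?thesis
    using kernel_of_admissible_epic unfolding admissible_monic_def by blast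
qed


section \<open>Morphisms of short exact sequences\<close>

text \<open>With elements: if \<open>p x = p' y\<close>, then \<open>y - s x = j' l\<close> for some
  \<open>l\<close>, hence \<open>y = s (x + j l)\<close>. The proof makes this choice once, on the
  fibre product \<open>G\<close> of \<open>p\<close> and \<open>p'\<close>, and then descends along
  the admissible epic \<open>q'\<close> to \<open>P'\<close>.\<close>

lemma iso_middle_of_identities:
  assumes "(j, p) \<in> E" "j \<in> Hom C A P" "p \<in> Hom C P D"
    and "(j', p') \<in> E" "j' \<in> Hom C A P'" "p' \<in> Hom C P' D"
    and "s \<in> Hom C P P'" "s \<cdot> j = j'" "p' \<cdot> s = p"
  shows "is_isomorphism C s"
proof -
  note ker = short_exact_kernel[OF assms(1-3)] and ker' = short_exact_kernel[OF assms(4-6)]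
  \<comment> \<open>If \<open>s\<close> kills \<open>x\<close>, so does
    \<open>p = p' \<cdot> s\<close>. Hence \<open>x = j \<cdot> y\<close>, and
    \<open>j' \<cdot> y = s \<cdot> x = 0\<close> forces \<open>y = 0\<close>.\<close>
  have kills: "x = Zero C X P" if x: "x \<in> Hom C X P" "s \<cdot> x = Zero C X P'" for X x
  proof -
    have obj: "X \<in> Obj C" "A \<in> Obj C"
      using Hom_Obj x(1) assms(2) by blast+
    have "p \<cdot> x = Zero C X D"
      using Comp_assoc[OF x(1) assms(7,6)] assms(9) x(2) Comp_Zero[OF assms(6) obj(1)] by simp
    then obtain y where y: "y \<in> Hom C X A" "j \<cdot> y = x"
      using ker(2)[OF x(1)] by blast
    have "j' \<cdot> y = j' \<cdot> Zero C X A"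
      using Comp_assoc[OF y(1) assms(2,7)] assms(8) y(2) x(2) Comp_Zero[OF assms(5) obj(1)] by simp
    then show ?thesis
      using ker'(3)[OF y(1) Zero_Hom[OF obj]] y(2) Comp_Zero[OF assms(2) obj(1)] by simp
  qed
  have mono: "x = y" if xy: "x \<in> Hom C X P" "y \<in> Hom C X P" "s \<cdot> x = s \<cdot> y" for X x y
  proof -
    obtain d where d: "d \<in> Hom C X P" "x \<boxplus> d = y"
      using ex_complement[OF xy(1,2)] by blast
    have sx: "s \<cdot> x \<in> Hom C X P'" "s \<cdot> d \<in> Hom C X P'"
      using Comp_Hom xy(1) d(1) assms(7) by blast+
    have "(s \<cdot> x) \<boxplus> (s \<cdot> d) = (s \<cdot> x) \<boxplus> Zero C X P'"
      using Comp_Add[OF xy(1) d(1) assms(7)] d(2) xy(3) Add_Zero[OF sx(1)] by simp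
    then have "s \<cdot> d = Zero C X P'"
      using Add_cancel_left[OF sx] Zero_Hom Hom_Obj sx(1) by blast
    then show ?thesis
      using kills[OF d(1)] d(2) Add_Zero[OF xy(1)] by simp
  qed
  obtain q q' where pb: "is_pullback C p p' q q'" "admissible_epic E q'"
    using epic_pullback[OF assms(3) _ assms(6)] assms(1) unfolding admissible_epic_def by blast
  obtain G where GH: "q \<in> Hom C G P" "q' \<in> Hom C G P'"
    using is_pullback_Hom[OF pb(1) assms(3,6)] by blast
  note pullback = is_pullback_universal[OF pb(1) assms(3,6) GH]
  note G = GH pullback(1) and lift = pullback(2)
  have id: "Ident C P \<in> Hom C P P" "Ident C P' \<in> Hom C P' P'" "Ident C G \<in> Hom C G G"
    using Ident_Hom Hom_Obj assms(7) G(1) by blast+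
  \<comment> \<open>The graph of \<open>s\<close>: a section of \<open>q\<close> with second
    component \<open>s\<close>.\<close>
  obtain k where k: "k \<in> Hom C P G" "q \<cdot> k = Ident C P" "q' \<cdot> k = s"
    using lift[OF id(1) assms(7)] Comp_Ident[OF assms(3)] assms(9) by auto
  have kq: "k \<cdot> q \<in> Hom C G G"
    using Comp_Hom[OF G(1) k(1)] .
  \<comment> \<open>Here \<open>h = 1 - k \<cdot> q\<close>, so that \<open>q \<cdot> h = 0\<close>
    and \<open>q' \<cdot> h\<close> is the difference \<open>y - s x\<close> of the two
    coordinates.\<close>
  obtain h where h: "h \<in> Hom C G G" "(k \<cdot> q) \<boxplus> h = Ident C G"
    using ex_complement[OF kq id(3)] by blast
  have sq: "s \<cdot> q \<in> Hom C G P'"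
    using Comp_Hom[OF G(1) assms(7)] .
  have qh: "q \<cdot> h \<in> Hom C G P" and q'h: "q' \<cdot> h \<in> Hom C G P'"
    using Comp_Hom[OF h(1)] G by blast+
  have "q \<boxplus> (q \<cdot> h) = q \<boxplus> Zero C G P"
    using Comp_Add[OF kq h(1) G(1)] Comp_assoc[OF G(1) k(1) G(1)] k(2) h(2) Ident_Comp[OF G(1)]
      Comp_Ident[OF G(1)] Add_Zero[OF G(1)] by simp
  then have qh0: "q \<cdot> h = Zero C G P"
    using Add_cancel_left[OF G(1) qh] Zero_Hom Hom_Obj[OF G(1)] by blast
  have "p' \<cdot> (q' \<cdot> h) = Zero C G D"
    using Comp_assoc[OF h(1) G(2) assms(6)] Comp_assoc[OF h(1) G(1) assms(3)] G(3) qh0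
      Comp_Zero[OF assms(3)] Hom_Obj[OF G(1)] by simp
  then obtain l where l: "l \<in> Hom C G A" "j' \<cdot> l = q' \<cdot> h"
    using ker'(2)[OF q'h] by blast
  \<comment> \<open>The corrected first coordinate \<open>x + j l\<close>, chosen so that
    \<open>s \<cdot> w = q'\<close>.\<close>
  define w where "w = q \<boxplus> (j \<cdot> l)"
  have jl: "j \<cdot> l \<in> Hom C G P"
    using Comp_Hom[OF l(1) assms(2)] .
  have w: "w \<in> Hom C G P"
    unfolding w_def by (rule Add_Hom[OF G(1) jl])
  have "q' = (s \<cdot> q) \<boxplus> (q' \<cdot> h)"
    using Comp_Add[OF kq h(1) G(2)] Comp_assoc[OF G(1) k(1) G(2)] k(3) h(2) Comp_Ident[OF G(2)]
    by simp
  also have "\<dots> = s \<cdot> w"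
    using Comp_Add[OF G(1) jl assms(7)] Comp_assoc[OF l(1) assms(2,7)] assms(8) l(2)
    unfolding w_def by simp
  finally have q'w: "q' = s \<cdot> w" .
  obtain n where n: "(n, q') \<in> E"
    using pb(2) unfolding admissible_epic_def by blast
  then obtain N where N: "n \<in> Hom C N G"
    using short_exact_Hom(1) G(2) by blast
  note coker = short_exact_cokernel[OF n N G(2)]
  \<comment> \<open>Since \<open>s\<close> kills only zero, \<open>w\<close> vanishes on the kernel
    \<open>n\<close> of \<open>q'\<close> and therefore descends along \<open>q'\<close> to the
    inverse \<open>t\<close>.\<close>
  have "s \<cdot> (w \<cdot> n) = Zero C N P'"
    using Comp_assoc[OF N w assms(7)] q'w short_exact_kernel(1)[OF n N G(2)] by simp
  then have "w \<cdot> n = Zero C N P"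
    using kills Comp_Hom[OF N w] by blast
  then obtain t where t: "t \<in> Hom C P' P" "t \<cdot> q' = w"
    using coker(1)[OF w] by blast
  have "(s \<cdot> t) \<cdot> q' = Ident C P' \<cdot> q'"
    using Comp_assoc[OF G(2) t(1) assms(7)] t(2) q'w Ident_Comp[OF G(2)] by simp
  then have st: "s \<cdot> t = Ident C P'"
    using coker(2) Comp_Hom[OF t(1) assms(7)] id(2) by blast
  have "s \<cdot> (t \<cdot> s) = s \<cdot> Ident C P"
    using Comp_assoc[OF assms(7) t(1) assms(7)] st Ident_Comp[OF assms(7)] Comp_Ident[OF assms(7)]
    by simp
  then have "t \<cdot> s = Ident C P"
    using mono Comp_Hom[OF assms(7) t(1)] id(1) by blast
  then show ?thesis
    using is_isomorphismI[OF assms(7) t(1) _ st] by blast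
qed

text \<open>The outer isomorphisms are absorbed into the first sequence:
  \<open>(f' \<cdot> t, c \<cdot> g')\<close>, with \<open>t\<close> inverse to \<open>a\<close>,
  has the same middle object and the outer objects of \<open>(f, g)\<close>.\<close>

lemma iso_middle:
  assumes "(f', g') \<in> E" "f' \<in> Hom C A' B'" "g' \<in> Hom C B' D'"
    and "(f, g) \<in> E" "f \<in> Hom C A B" "g \<in> Hom C B D"
    and "a \<in> Hom C A' A" "b \<in> Hom C B' B" "c \<in> Hom C D' D"
    and "b \<cdot> f' = f \<cdot> a" "c \<cdot> g' = g \<cdot> b"
    and "is_isomorphism C a" "is_isomorphism C c"
  shows "is_isomorphism C b"
proof -
  obtain t where t: "t \<in> Hom C A A'" "t \<cdot> a = Ident C A'" "a \<cdot> t = Ident C A" "is_isomorphism C t"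
    by (rule is_isomorphismE[OF assms(12,7)])
  have id: "Ident C B' \<in> Hom C B' B'" "Ident C A \<in> Hom C A A"
    "is_isomorphism C (Ident C B')"
    using Ident_Hom is_isomorphism_Ident Hom_Obj[OF assms(2)] Hom_Obj[OF t(1)] by auto
  have f't: "f' \<cdot> t \<in> Hom C A B'" and cg': "c \<cdot> g' \<in> Hom C B' D"
    using Comp_Hom[OF t(1) assms(2)] Comp_Hom[OF assms(3,9)] by auto
  have "Ident C B' \<cdot> f' = (f' \<cdot> t) \<cdot> a"
    using Comp_assoc[OF assms(7) t(1) assms(2)] t(2) Comp_Ident[OF assms(2)] Ident_Comp[OF assms(2)]
    by simp
  then have E': "(f' \<cdot> t, c \<cdot> g') \<in> E"
    using E_iso_closed[OF assms(1-3) f't cg' assms(7) id(1) assms(9,12) id(3) assms(13)]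
      Comp_Ident[OF cg'] by simp
  have "b \<cdot> (f' \<cdot> t) = f"
    using Comp_assoc[OF t(1) assms(2,8)] Comp_assoc[OF t(1) assms(7,5)] assms(10) t(3)
      Comp_Ident[OF assms(5)] by simp
  then show ?thesis
    using iso_middle_of_identities[OF E' f't cg' assms(4-6,8)] assms(11) by simp
qed

text \<open>Lets one square be read both as the push-out of \<open>a\<close> along \<open>f'\<close>
  and as that of \<open>f'\<close> along \<open>a\<close>.\<close>

lemma is_pushout_flip:
  assumes "is_pushout C i f f' i'"
  shows "is_pushout C f i i' f'"
proof -
  obtain X Y X' P
    where H: "i \<in> Hom C X Y" "f \<in> Hom C X X'" "f' \<in> Hom C Y P" "i' \<in> Hom C X' P" "f' \<cdot> i = i' \<cdot> f"
      and univ: "\<forall>Z \<in> Obj C. \<forall>u \<in> Hom C Y Z. \<forall>v \<in> Hom C X' Z. u \<cdot> i = v \<cdot> f \<longrightarrow>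
        (\<exists>!w. w \<in> Hom C P Z \<and> w \<cdot> f' = u \<and> w \<cdot> i' = v)"
    using assms unfolding is_pushout_def by (elim exE conjE)
  have "\<exists>!w. w \<in> Hom C P Z \<and> w \<cdot> i' = u \<and> w \<cdot> f' = v"
    if "Z \<in> Obj C" "u \<in> Hom C X' Z" "v \<in> Hom C Y Z" "u \<cdot> f = v \<cdot> i" for Z u v
  proof -
    have "\<exists>!w. w \<in> Hom C P Z \<and> w \<cdot> f' = v \<and> w \<cdot> i' = u"
      using univ that by simp
    then show ?thesis
      by (simp only: conj_commute)
  qed
  then show ?thesis
    unfolding is_pushout_def
    by (intro exI[of _ X] exI[of _ X'] exI[of _ Y] exI[of _ P]) (simp add: H)
qed

section \<open>Admissible monics and epics at both ends\<close>

lemma admissible_monic_middle: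
  assumes "(f', g') \<in> E" "f' \<in> Hom C A' B'" "g' \<in> Hom C B' D'"
    and "(f, g) \<in> E" "f \<in> Hom C A B" "g \<in> Hom C B D"
    and "a \<in> Hom C A' A" "b \<in> Hom C B' B" "c \<in> Hom C D' D"
    and "b \<cdot> f' = f \<cdot> a" "c \<cdot> g' = g \<cdot> b"
    and "admissible_monic E a" "admissible_monic E c"
  shows "admissible_monic E b"
proof -
  have epic: "admissible_epic E g"
    using assms(4) unfolding admissible_epic_def by blast
  obtain d p where pb: "is_pullback C g c d p" "admissible_epic E p"
    using epic_pullback[OF assms(6) epic assms(9)] by blast
  obtain Q where QH: "d \<in> Hom C Q B" "p \<in> Hom C Q D'"
    using is_pullback_Hom[OF pb(1) assms(6,9)] by blast
  note pullback = is_pullback_universal[OF pb(1) assms(6,9) QH]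
  note Q = QH pullback(1) and lift = pullback(2) and unique = pullback(3)
  have d: "admissible_monic E d"
    using admissible_monic_pullback[OF pb(1) assms(13) epic assms(6,9)] .
  obtain n where n: "(n, p) \<in> E" "d \<cdot> n = f"
    using pullback_short_exact[OF pb(1) assms(4,6,9,5) pb(2)] by blast
  obtain A\<^sub>0 where A\<^sub>0: "n \<in> Hom C A\<^sub>0 Q"
    using short_exact_Hom(1)[OF n(1) Q(2)] by blast
  \<comment> \<open>The source of \<open>n\<close> is that of
    \<open>d \<cdot> n = f\<close>.\<close>
  then have nH: "n \<in> Hom C A Q"
    using Comp_Hom[OF A\<^sub>0 Q(1)] n(2) assms(5) by (simp add: Hom_def)
  obtain e where e: "e \<in> Hom C B' Q" "d \<cdot> e = b" "p \<cdot> e = g'"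
    using lift[OF assms(8,3)] assms(11) by auto
  have pn: "p \<cdot> n = Zero C A D'"
    using short_exact_kernel(1)[OF n(1) nH Q(2)] .
  \<comment> \<open>Equality of \<open>e \<cdot> f'\<close> and \<open>n \<cdot> a\<close> is tested
    on both projections of the pull-back; on \<open>p\<close> both give zero.\<close>
  have "p \<cdot> (e \<cdot> f') = p \<cdot> (n \<cdot> a)"
    using Comp_assoc[OF assms(2) e(1) Q(2)] Comp_assoc[OF assms(7) nH Q(2)] e(3) pn
      short_exact_kernel(1)[OF assms(1-3)] Zero_Comp[OF assms(7)] Hom_Obj[OF assms(9)] by simp
  moreover have "d \<cdot> (e \<cdot> f') = d \<cdot> (n \<cdot> a)"
    using Comp_assoc[OF assms(2) e(1) Q(1)] Comp_assoc[OF assms(7) nH Q(1)] e(2) n(2) assms(10) by simp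
  ultimately have ef: "e \<cdot> f' = n \<cdot> a"
    using unique Comp_Hom[OF assms(2) e(1)] Comp_Hom[OF assms(7) nH] by blast
  \<comment> \<open>Pushing \<open>a\<close> out along \<open>f'\<close> makes \<open>a'\<close> an
    admissible monic at once; the flipped square then makes \<open>n'\<close> the start of a short
    exact sequence.\<close>
  obtain n' a' where po: "is_pushout C a f' n' a'" "admissible_monic E a'"
    using monic_pushout[OF assms(7,12,2)] by blast
  interpret op: exact_category "op_cat C" "E\<inverse>"
    by (rule exact_category_op_cat)
  obtain P where P: "n' \<in> Hom C A P" "a' \<in> Hom C B' P"
    using op.is_pullback_Hom[of a f' n' a' A A' B'] po(1) assms(2,7) by auto
  have desc: "\<exists>w \<in> Hom C P X. w \<cdot> n' = u \<and> w \<cdot> a' = v"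
    if "u \<in> Hom C A X" "v \<in> Hom C B' X" "u \<cdot> a = v \<cdot> f'" for X u v
    using op.is_pullback_universal(2)[of a f' n' a' A A' B' P u X v] po(1) assms(2,7) P that by simp
  have unique': "w = w'"
    if "w \<in> Hom C P X" "w' \<in> Hom C P X" "w \<cdot> n' = w' \<cdot> n'" "w \<cdot> a' = w' \<cdot> a'" for X w w'
    using op.is_pullback_universal(3)[of a f' n' a' A A' B' P w X w'] po(1) assms(2,7) P that by simp
  obtain r where r: "(n', r) \<in> E" "r \<cdot> a' = g'"
    using pushout_short_exact[OF is_pushout_flip[OF po(1)] assms(1,2,7,3)] by blast
  obtain D\<^sub>0 where D\<^sub>0: "r \<in> Hom C P D\<^sub>0"
    using short_exact_Hom(2)[OF r(1) P(1)] by blast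
  then have rH: "r \<in> Hom C P D'"
    using Comp_Hom[OF P(2) D\<^sub>0] r(2) assms(3) by (simp add: Hom_def)
  \<comment> \<open>\<open>s\<close> compares the push-out sequence \<open>(n', r)\<close> with the
    pull-back sequence \<open>(n, p)\<close>, which share both outer objects; it splits
    \<open>b\<close> as \<open>d \<cdot> s \<cdot> a'\<close>.\<close>
  obtain s where s: "s \<in> Hom C P Q" "s \<cdot> n' = n" "s \<cdot> a' = e"
    using desc[OF nH e(1)] ef by auto
  have "p \<cdot> s = r"
    \<comment> \<open>Both morphisms out of the push-out are zero on \<open>n'\<close> and equal
      \<open>g'\<close> on \<open>a'\<close>.\<close>
    using unique'[OF Comp_Hom[OF s(1) Q(2)] rH] Comp_assoc[OF P(1) s(1) Q(2)]
      Comp_assoc[OF P(2) s(1) Q(2)] s(2,3) pn e(3) r(2) short_exact_kernel(1)[OF r(1) P(1) rH] by simp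
  then have "is_isomorphism C s"
    using iso_middle_of_identities[OF r(1) P(1) rH n(1) nH Q(2) s(1,2)] by blast
  then have "admissible_monic E e"
    using monic_Comp[OF P(2) s(1) po(2)] iso_admissible_monic s(3) by simp
  then show ?thesis
    using monic_Comp[OF e(1) Q(1) _ d] e(2) by simp
qed

text \<open>In the opposite category \<open>(c, b, a)\<close> is a morphism from
  \<open>(g, f)\<close> to \<open>(g', f')\<close> with admissible monics at the ends.\<close>

lemma admissible_epic_middle:
  assumes "(f', g') \<in> E" "f' \<in> Hom C A' B'" "g' \<in> Hom C B' D'"
    and "(f, g) \<in> E" "f \<in> Hom C A B" "g \<in> Hom C B D"
    and "a \<in> Hom C A' A" "b \<in> Hom C B' B" "c \<in> Hom C D' D"
    and "b \<cdot> f' = f \<cdot> a" "c \<cdot> g' = g \<cdot> b"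
    and "admissible_epic E a" "admissible_epic E c"
  shows "admissible_epic E b"
  using exact_category.admissible_monic_middle[OF exact_category_op_cat,
      of g f D B A g' f' D' B' A' c b a] assms by simp

end

theorem corollary3p2:
  fixes \<A> :: "('o, 'm, 'x) add_cat_scheme" and E :: "('m \<times> 'm) set"
    and A' B' C' A B C :: 'o and f' g' f g a b c :: 'm
  assumes "exact_category \<A> E"
    and "f' \<in> Hom \<A> A' B'" and "g' \<in> Hom \<A> B' C'" and "(f', g') \<in> E"
    and "f \<in> Hom \<A> A B" and "g \<in> Hom \<A> B C" and "(f, g) \<in> E"
    and "a \<in> Hom \<A> A' A" and "b \<in> Hom \<A> B' B" and "c \<in> Hom \<A> C' C"
    and "b \<cdot>\<^bsub>\<A>\<^esub> f' = f \<cdot>\<^bsub>\<A>\<^esub> a" and "c \<cdot>\<^bsub>\<A>\<^esub> g' = g \<cdot>\<^bsub>\<A>\<^esub> b"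
  shows "(is_isomorphism \<A> a \<and> is_isomorphism \<A> c \<longrightarrow> is_isomorphism \<A> b) \<and>
    (admissible_monic E a \<and> admissible_monic E c \<longrightarrow> admissible_monic E b) \<and>
    (admissible_epic E a \<and> admissible_epic E c \<longrightarrow> admissible_epic E b)"
proof -
  interpret exact_category \<A> E
    by (rule assms(1))
  note morphism = assms(4,2,3,7,5,6,8-12)
  show ?thesis
    using iso_middle[OF morphism] admissible_monic_middle[OF morphism]
      admissible_epic_middle[OF morphism] by blast
qed

end
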